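(* For every integer $k\ge 1$ and every integer $c\ge 0$, there are only finitely many (up to isomorphism) $k$-vertex-critical $(\text{co-gem}, P_5, P_3+cP_2)$-free graphs.
   Context: All graphs are finite and simple. $\chi(G)$ denotes the chromatic number of $G$. A graph $G$ is $k$-vertex-critical if $\chi(G)=k$ and $\chi(G-v)<k$ for every $v\in V(G)$. $P_n$ denotes the path on $n$ vertices, $G+H$ denotes the disjoint union of graphs $G$ and $H$, and $cG$ denotes the disjoint union of $c$ copies of $G$ (so $P_3+0P_2=P_3$). The co-gem is the graph $P_4+P_1$. A graph is $(H_1,\dots,H_m)$-free if none of $H_1,\dots,H_m$ is isomorphic to an induced subgraph of it. *)

theory Defs
  imports "Graph_Theory.Graph_Theory"
begin

text \<open>
  A finite simple graph is a \<^locale>\<open>pair_graph\<close>: a finite vertex set with a finite, irreflexive,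
  symmetric arc relation, each edge \<open>uv\<close> being the two arcs \<open>(u,v)\<close> and \<open>(v,u)\<close>.  The graph
  without vertices is allowed; its chromatic number is \<open>0\<close>.
\<close>

definition proper_colouring :: "('a,'b) pre_digraph \<Rightarrow> nat \<Rightarrow> ('a \<Rightarrow> nat) \<Rightarrow> bool" where
  "proper_colouring G k f \<longleftrightarrow>
     (\<forall>v\<in>verts G. f v < k) \<and> (\<forall>(u,v)\<in>arcs_ends G. f u \<noteq> f v)"

definition chromatic_number :: "('a,'b) pre_digraph \<Rightarrow> nat" where
  "chromatic_number G = (LEAST k. \<exists>f. proper_colouring G k f)"

definition vertex_critical :: "nat \<Rightarrow> ('a,'b) pre_digraph \<Rightarrow> bool" where
  "vertex_critical k G \<longleftrightarrow> chromatic_number G = k \<and>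
     (\<forall>v\<in>verts G. chromatic_number (pre_digraph.del_vert G v) < k)"

definition free_of :: "('a,'b) pre_digraph \<Rightarrow> ('c,'d) pre_digraph \<Rightarrow> bool" where
  "free_of H G \<longleftrightarrow> \<not> (\<exists>K. induced_subgraph K G \<and> digraph_iso H K)"

definition path_graph :: "nat \<Rightarrow> nat pair_pre_digraph" where
  "path_graph n = \<lparr> pverts = {..<n},
     parcs = {(i,j). i < n \<and> j < n \<and> (j = Suc i \<or> i = Suc j)} \<rparr>"

definition disjoint_union ::
    "'a pair_pre_digraph \<Rightarrow> 'b pair_pre_digraph \<Rightarrow> ('a + 'b) pair_pre_digraph" where
  "disjoint_union G H = \<lparr> pverts = pverts G <+> pverts H,
     parcs = {(Inl u, Inl v) | u v. (u,v) \<in> parcs G} \<union> {(Inr u, Inr v) | u v. (u,v) \<in> parcs H} \<rparr>"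

definition copies :: "nat \<Rightarrow> 'a pair_pre_digraph \<Rightarrow> (nat \<times> 'a) pair_pre_digraph" where
  "copies c G = \<lparr> pverts = {..<c} \<times> pverts G,
     parcs = {((i,u), (i,v)) | i u v. i < c \<and> (u,v) \<in> parcs G} \<rparr>"

definition co_gem :: "(nat + nat) pair_pre_digraph" where
  "co_gem = disjoint_union (path_graph 4) (path_graph 1)"

definition iso_rel :: "'a pair_pre_digraph set \<Rightarrow> 'a pair_pre_digraph rel" where
  "iso_rel S = {(G,H). G \<in> S \<and> H \<in> S \<and> digraph_iso (with_proj G) (with_proj H)}"

text \<open>
  The vertices are taken from an arbitrary type.  When it is infinite (for instance
  \<^typ>\<open>nat\<close>), every finite graph has an isomorphic copy on it, so that an isomorphism-invariant
  class of finite graphs is represented completely.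
\<close>

definition finite_up_to_iso :: "'a pair_pre_digraph set \<Rightarrow> bool" where
  "finite_up_to_iso S \<longleftrightarrow> finite (S // iso_rel S)"

lemma ex_proper_colouring:
  assumes "digraph G" shows "\<exists>f. proper_colouring G (chromatic_number G) f"
proof -
  interpret digraph G by fact
  obtain f where f: "bij_betw f (verts G) {0..<card (verts G)}"
    using ex_bij_betw_finite_nat[OF finite_verts] by blast
  have "f u \<noteq> f v" if "(u,v) \<in> arcs_ends G" for u v
    using that f adj_in_verts[OF that] adj_not_same[of u]
    by (auto simp: bij_betw_def inj_on_eq_iff)
  then have "proper_colouring G (card (verts G)) f"
    using bij_betwE[OF f] by (auto simp: proper_colouring_def)
  then have "\<exists>k f. proper_colouring G k f" by blast
  then show ?thesis unfolding chromatic_number_def by (rule LeastI_ex)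
qed

lemma pair_graph_path_graph: "pair_graph (path_graph n)"
proof -
  have "finite {(i,j). i < n \<and> j < n \<and> (j = Suc i \<or> i = Suc j)}"
    by (rule finite_subset[of _ "{..<n} \<times> {..<n}"]) auto
  then show ?thesis
    by unfold_locales (auto simp: path_graph_def symmetric_def sym_def)
qed

lemma pair_graph_disjoint_union:
  assumes "pair_graph G" "pair_graph H" shows "pair_graph (disjoint_union G H)"
proof -
  interpret G: pair_graph G by fact
  interpret H: pair_graph H by fact
  have eq: "parcs (disjoint_union G H) =
      map_prod Inl Inl ` parcs G \<union> map_prod Inr Inr ` parcs H"
    by (auto simp: disjoint_union_def image_iff)
  have "finite (parcs (disjoint_union G H))"
    using G.pair_finite_arcs H.pair_finite_arcs by (simp add: eq)
  moreover have "symmetric (with_proj (disjoint_union G H))"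
    unfolding symmetric_def with_proj_simps
    by (rule symI) (auto simp: disjoint_union_def intro: G.arcs_symmetric H.arcs_symmetric)
  ultimately show ?thesis
    using G.pair_finite_verts H.pair_finite_verts
    by unfold_locales
      (auto simp: disjoint_union_def
        dest: G.in_arcsD1 G.in_arcsD2 H.in_arcsD1 H.in_arcsD2 G.no_loops' H.no_loops')
qed

lemma pair_graph_copies:
  assumes "pair_graph G" shows "pair_graph (copies c G)"
proof -
  interpret G: pair_graph G by fact
  have eq: "parcs (copies c G) = (\<lambda>(i,u,v). ((i,u),(i,v))) ` ({..<c} \<times> parcs G)"
    by (force simp: copies_def image_iff)
  have "finite (parcs (copies c G))"
    using G.pair_finite_arcs by (simp add: eq)
  moreover have "symmetric (with_proj (copies c G))"
    unfolding symmetric_def with_proj_simps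
    by (rule symI) (auto simp: copies_def intro: G.arcs_symmetric)
  ultimately show ?thesis
    using G.pair_finite_verts
    by unfold_locales
      (auto simp: copies_def dest: G.in_arcsD1 G.in_arcsD2 G.no_loops')
qed

lemma digraph_iso_pair_iff:
  assumes "pair_wf_digraph G" "pair_wf_digraph H"
  shows "digraph_iso (with_proj G) (with_proj H) \<longleftrightarrow>
    (\<exists>f. bij_betw f (pverts G) (pverts H) \<and>
      (\<forall>u\<in>pverts G. \<forall>v\<in>pverts G. (u,v) \<in> parcs G \<longleftrightarrow> (f u, f v) \<in> parcs H))"
    (is "_ \<longleftrightarrow> (\<exists>f. ?iso f)")
proof
  interpret G: pair_wf_digraph G by fact
  assume "digraph_iso (with_proj G) (with_proj H)"
  then obtain h where h: "pre_digraph.digraph_isomorphism (with_proj G) h"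
    and H: "with_proj H = app_iso h (with_proj G)"
    by (auto simp: digraph_iso_def)
  let ?f = "iso_verts h"
  have V: "pverts H = ?f ` pverts G" and A: "parcs H = iso_arcs h ` parcs G"
    and t: "iso_tail h = fst" and hd: "iso_head h = snd"
    using H by (auto simp: with_proj_def app_iso_def)
  have inj: "inj_on ?f (pverts G)"
    using h by (simp add: pre_digraph.digraph_isomorphism_def)
  have arc: "iso_arcs h a = (?f (fst a), ?f (snd a))" if "a \<in> parcs G" for a
    using h that t hd
    by (simp add: pre_digraph.digraph_isomorphism_def prod_eq_iff)
  have "(u,v) \<in> parcs G" if that': "u \<in> pverts G" "v \<in> pverts G" "(?f u, ?f v) \<in> parcs H" for u v
  proof -
    obtain a where a: "a \<in> parcs G" "(?f u, ?f v) = iso_arcs h a" using that'(3) A by auto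
    then have "fst a \<in> pverts G" "snd a \<in> pverts G" "?f u = ?f (fst a)" "?f v = ?f (snd a)"
      using arc G.arc_fst_in_verts G.arc_snd_in_verts by auto
    then have "u = fst a" "v = snd a" using inj that'(1,2) by (meson inj_onD)+
    then show ?thesis using a by simp
  qed
  moreover have "(?f u, ?f v) \<in> parcs H" if "(u,v) \<in> parcs G" for u v
    using arc[OF that] imageI[OF that, of "iso_arcs h"] A by simp
  ultimately have "?iso ?f"
    using inj V unfolding bij_betw_def by blast
  then show "\<exists>f. ?iso f" by blast
next
  interpret G: pair_wf_digraph G by fact
  interpret H: pair_wf_digraph H by fact
  assume "\<exists>f. ?iso f"
  then obtain f where f: "?iso f" ..
  define h where
    "h = \<lparr> iso_verts = f, iso_arcs = map_prod f f, iso_head = snd, iso_tail = fst \<rparr>"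
  have inj: "inj_on f (pverts G)" and im: "f ` pverts G = pverts H"
    using f by (auto simp: bij_betw_def)
  have "inj_on (map_prod f f) (parcs G)"
    by (rule inj_on_subset[OF map_prod_inj_on[OF inj inj]]) (auto dest: G.in_arcsD1 G.in_arcsD2)
  then have 1: "pre_digraph.digraph_isomorphism (with_proj G) h"
    using inj assms(1) by (simp add: pre_digraph.digraph_isomorphism_def h_def wf_digraph_wp_iff)
  have "parcs H = map_prod f f ` parcs G"
  proof (intro equalityI subsetI)
    fix e assume e: "e \<in> parcs H"
    obtain x y where xy: "e = (x, y)" by (cases e)
    then have "x \<in> f ` pverts G" "y \<in> f ` pverts G"
      using e im by (auto dest: H.in_arcsD1 H.in_arcsD2)
    then obtain u v where "u \<in> pverts G" "v \<in> pverts G" "e = (f u, f v)"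
      using xy by auto
    with e f have "(u,v) \<in> parcs G" by auto
    with \<open>e = (f u, f v)\<close> show "e \<in> map_prod f f ` parcs G" by force
  next
    fix e assume "e \<in> map_prod f f ` parcs G"
    then obtain u v where uv: "(u,v) \<in> parcs G" "e = (f u, f v)" by auto
    then have "u \<in> pverts G" "v \<in> pverts G" by (auto dest: G.in_arcsD1 G.in_arcsD2)
    with uv f show "e \<in> parcs H" by auto
  qed
  then have "with_proj H = app_iso h (with_proj G)"
    using im by (simp add: with_proj_def app_iso_def h_def)
  with 1 show "digraph_iso (with_proj G) (with_proj H)"
    by (auto simp: digraph_iso_def)
qed

lemma equiv_iso_rel:
  assumes "\<And>G. G \<in> S \<Longrightarrow> pair_graph G" shows "equiv S (iso_rel S)"
proof -
  have wf: "pair_wf_digraph G" if "G \<in> S" for G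
  proof -
    interpret pair_graph G using assms that .
    show ?thesis ..
  qed
  have iff: "(G,H) \<in> iso_rel S \<longleftrightarrow> G \<in> S \<and> H \<in> S \<and>
      (\<exists>f. bij_betw f (pverts G) (pverts H) \<and>
        (\<forall>u\<in>pverts G. \<forall>v\<in>pverts G. (u,v) \<in> parcs G \<longleftrightarrow> (f u, f v) \<in> parcs H))" for G H
    by (auto simp: iso_rel_def digraph_iso_pair_iff[OF wf wf])
  show ?thesis
  proof (rule equivI)
    show "iso_rel S \<subseteq> S \<times> S" by (auto simp: iso_rel_def)
    show "refl_on S (iso_rel S)"
      by (rule refl_onI) (auto simp: iff intro!: exI[of _ id])
    show "sym (iso_rel S)"
    proof (rule symI)
      fix G H assume "(G,H) \<in> iso_rel S"
      then obtain f where S: "G \<in> S" "H \<in> S" and b: "bij_betw f (pverts G) (pverts H)"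
        and e: "\<forall>u\<in>pverts G. \<forall>v\<in>pverts G. (u,v) \<in> parcs G \<longleftrightarrow> (f u, f v) \<in> parcs H"
        unfolding iff by blast
      let ?g = "inv_into (pverts G) f"
      have "bij_betw ?g (pverts H) (pverts G)" using b by (rule bij_betw_inv_into)
      moreover have "(u,v) \<in> parcs H \<longleftrightarrow> (?g u, ?g v) \<in> parcs G"
        if "u \<in> pverts H" "v \<in> pverts H" for u v
        using that e b bij_betw_inv_into_right[OF b] bij_betwE[OF \<open>bij_betw ?g _ _\<close>] by simp
      ultimately show "(H,G) \<in> iso_rel S" using S unfolding iff by blast
    qed
    show "trans (iso_rel S)"
    proof (rule transI)
      fix G H K assume "(G,H) \<in> iso_rel S" "(H,K) \<in> iso_rel S"
      then obtain f g where S: "G \<in> S" "K \<in> S"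
        and b: "bij_betw f (pverts G) (pverts H)" "bij_betw g (pverts H) (pverts K)"
        and e: "\<forall>u\<in>pverts G. \<forall>v\<in>pverts G. (u,v) \<in> parcs G \<longleftrightarrow> (f u, f v) \<in> parcs H"
          "\<forall>u\<in>pverts H. \<forall>v\<in>pverts H. (u,v) \<in> parcs H \<longleftrightarrow> (g u, g v) \<in> parcs K"
        unfolding iff by blast
      have "bij_betw (g \<circ> f) (pverts G) (pverts K)" using b by (rule bij_betw_trans)
      moreover have "\<forall>u\<in>pverts G. \<forall>v\<in>pverts G.
          (u,v) \<in> parcs G \<longleftrightarrow> ((g \<circ> f) u, (g \<circ> f) v) \<in> parcs K"
        using e bij_betwE[OF b(1)] by simp
      ultimately show "(G,K) \<in> iso_rel S" using S unfolding iff by blast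
    qed
  qed
qed

end

theory Submission
  imports Defs "HOL-Library.Ramsey"
begin

text \<open>
  Call a set of pairwise anticomplete \<open>r\<close>-cliques a family.  Downward induction on \<open>r\<close> bounds
  the size of a family in terms of \<open>k\<close> and \<open>c\<close> only: there is no \<open>(k+1)\<close>-clique, and a bound for
  \<open>r = 1\<close> bounds the independence number, hence the order of the graph by Ramsey's theorem.

  A vertex distinguishing two vertices of a clique \<open>Q\<close> of a large family does so for no other
  clique of the family (\<open>P\<^sub>5\<close>), and is anticomplete to fewer than \<open>c\<close> of them (\<open>P\<^sub>3 + cP\<^sub>2\<close>).
  Two such vertices belonging to different cliques therefore have a common neighbour in a third
  one, and the exclusion of \<open>P\<^sub>5\<close> and the co-gem forces them to be adjacent.  Hence at most \<open>k\<close>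
  cliques have such a vertex; all others are modules.

  For nonadjacent \<open>y\<close> and \<open>z\<close>, the sets \<open>T y\<close>, \<open>T z\<close> of the modules they are complete to, if
  nonempty, proper and distinct, are disjoint: crossing sets give \<open>P\<^sub>5\<close>, nested ones a co-gem.
  If there are many such sets, Ramsey's theorem gives many pairwise nonadjacent vertices with
  disjoint sets, and adding each to a module of its set produces a large family of
  \<open>(r+1)\<close>-cliques.  So there are few sets; by criticality they separate the modules, so there are
  few modules.
\<close>

text \<open>Criticality is expressed through colourings alone. The axioms for P5 and the co-gem need
  no distinctness conditions, because the prescribed adjacencies and nonadjacencies force it. For P3
  the condition \<open>x \<noteq> z\<close> has to be stated, since \<open>x = z\<close> fits the
  pattern.\<close>

locale critical_forbidden =
  fixes V :: "'a set" and E :: "'a \<Rightarrow> 'a \<Rightarrow> bool" and k c :: nat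
  assumes finite_V: "finite V"
    and E_V: "E u v \<Longrightarrow> u \<in> V"
    and E_sym: "E u v \<Longrightarrow> E v u"
    and E_irrefl: "\<not> E v v"
    and P5_free: "\<lbrakk>E a b; E b p; E p q; E q r; \<not> E a p; \<not> E a q; \<not> E a r; \<not> E b q; \<not> E b r;
      \<not> E p r\<rbrakk> \<Longrightarrow> False"
    and co_gem_free: "\<lbrakk>E a b; E b p; E p q; \<not> E a p; \<not> E a q; \<not> E b q;
      w \<in> V; \<not> E w a; \<not> E w b; \<not> E w p; \<not> E w q\<rbrakk> \<Longrightarrow> False"
    and P3_matching_free: "\<lbrakk>E x y; E y z; x \<noteq> z; \<not> E x z;
      \<And>i. i < c \<Longrightarrow> E (f i) (g i);
      \<And>i v. i < c \<Longrightarrow> v \<in> {x, y, z} \<Longrightarrow> \<not> E v (f i) \<and> \<not> E v (g i);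
      \<And>i j. i < c \<Longrightarrow> j < c \<Longrightarrow> i \<noteq> j \<Longrightarrow>
        \<not> E (f i) (f j) \<and> \<not> E (f i) (g j) \<and> \<not> E (g i) (g j)\<rbrakk> \<Longrightarrow> False"
    and ex_colouring: "\<exists>f::'a \<Rightarrow> nat. (\<forall>v\<in>V. f v < k) \<and> (\<forall>u v. E u v \<longrightarrow> f u \<noteq> f v)"
    and no_smaller_colouring:
      "\<lbrakk>\<And>v. v \<in> V \<Longrightarrow> (h::'a \<Rightarrow> nat) v < k - 1; \<And>u v. E u v \<Longrightarrow> h u \<noteq> h v\<rbrakk> \<Longrightarrow> False"
    and ex_colouring_remove: "v \<in> V \<Longrightarrow> \<exists>f::'a \<Rightarrow> nat. (\<forall>u\<in>V - {v}. f u < k - 1) \<and>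
      (\<forall>u w. E u w \<longrightarrow> u \<noteq> v \<longrightarrow> w \<noteq> v \<longrightarrow> f u \<noteq> f w)"
begin

section \<open>Cliques, anticomplete families and basic forbidden configurations\<close>

lemma E_commute: "E u v \<longleftrightarrow> E v u"
  using E_sym by blast

definition is_clique :: "'a set \<Rightarrow> bool" where
  "is_clique K \<longleftrightarrow> K \<subseteq> V \<and> (\<forall>u\<in>K. \<forall>v\<in>K. u \<noteq> v \<longrightarrow> E u v)"

definition clique_family :: "nat \<Rightarrow> 'a set set \<Rightarrow> bool" where
  "clique_family r \<Q> \<longleftrightarrow> (\<forall>Q\<in>\<Q>. is_clique Q \<and> card Q = r) \<and>
     (\<forall>Q\<in>\<Q>. \<forall>Q'\<in>\<Q>. Q \<noteq> Q' \<longrightarrow> (\<forall>u\<in>Q. \<forall>v\<in>Q'. u \<noteq> v \<and> \<not> E u v))"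

definition anticomplete :: "'a \<Rightarrow> 'a set \<Rightarrow> bool" where
  "anticomplete y Q \<longleftrightarrow> (\<forall>u\<in>Q. \<not> E y u)"

definition complete :: "'a \<Rightarrow> 'a set \<Rightarrow> bool" where
  "complete y Q \<longleftrightarrow> (\<forall>u\<in>Q. E y u)"

text \<open>Members of \<open>Q\<close> are excluded because \<open>E\<close> is irreflexive: a
  vertex of a clique of size at least 2 is neither complete nor anticomplete to that clique. A
  clique on which no vertex is mixed is a module.\<close>

definition mixed :: "'a \<Rightarrow> 'a set \<Rightarrow> bool" where
  "mixed y Q \<longleftrightarrow> y \<notin> Q \<and> \<not> complete y Q \<and> \<not> anticomplete y Q"

lemma card_clique_le:
  assumes "is_clique K" shows "card K \<le> k"
proof -
  obtain f :: "'a \<Rightarrow> nat" where f: "\<forall>v\<in>V. f v < k" "\<forall>u v. E u v \<longrightarrow> f u \<noteq> f v"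
    using ex_colouring by blast
  have "inj_on f K" using assms f(2) by (metis inj_onI is_clique_def)
  moreover have "f ` K \<subseteq> {..<k}" using assms f(1) by (auto simp: is_clique_def)
  ultimately have "card K \<le> card {..<k}" by (intro card_inj_on_le) auto
  then show ?thesis by simp
qed

lemma clique_familyD:
  assumes "clique_family r \<Q>" "Q \<in> \<Q>"
  shows "is_clique Q" "card Q = r" "Q \<subseteq> V" "finite Q"
  using assms finite_subset[OF _ finite_V] by (auto simp: clique_family_def is_clique_def)

lemma clique_family_edge:
  assumes "clique_family r \<Q>" "Q \<in> \<Q>" "u \<in> Q" "v \<in> Q" "u \<noteq> v"
  shows "E u v"
  using assms by (auto simp: clique_family_def is_clique_def)

lemma clique_family_nonedge:
  assumes "clique_family r \<Q>" "Q \<in> \<Q>" "Q' \<in> \<Q>" "Q \<noteq> Q'" "u \<in> Q" "v \<in> Q'"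
  shows "\<not> E u v" "u \<noteq> v"
  using assms by (auto simp: clique_family_def)

lemma finite_clique_family:
  assumes "clique_family r \<Q>" shows "finite \<Q>"
  by (rule finite_subset[of _ "Pow V"])
    (use assms finite_V in \<open>auto simp: clique_family_def is_clique_def\<close>)

lemma clique_family_subset:
  assumes "clique_family r \<Q>" "\<R> \<subseteq> \<Q>" shows "clique_family r \<R>"
  using subsetD[OF assms(2)] assms(1) clique_familyD(1,2)[OF assms(1)]
    clique_family_nonedge[OF assms(1)]
  unfolding clique_family_def by metis

text \<open>The path \<open>a\<close>, \<open>y\<close>, \<open>l\<close>, \<open>z\<close>,
  \<open>b\<close> is an induced P5.\<close>

lemma nonadjacent_crossing:
  assumes "\<not> E y z" "E y a" "\<not> E z a" "E z b" "\<not> E y b" "E y l" "E z l"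
    "\<not> E a b" "\<not> E a l" "\<not> E b l"
  shows False
  using P5_free[of a y l z b] assms by (simp add: E_commute)

text \<open>The path \<open>a\<close>, \<open>y\<close>, \<open>l\<close>, \<open>z\<close> is an
  induced P4, and \<open>w\<close> is the isolated vertex completing a co-gem.\<close>

lemma nonadjacent_nested:
  assumes "\<not> E y z" "E y a" "\<not> E z a" "E y l" "E z l" "w \<in> V" "\<not> E y w" "\<not> E z w"
    "\<not> E a l" "\<not> E a w" "\<not> E l w"
  shows False
  using co_gem_free[of a y l z w] assms by (simp add: E_commute)

section \<open>Vertices mixed on a clique\<close>

lemma mixedE:
  assumes "mixed y Q" obtains u v where "u \<in> Q" "v \<in> Q" "E y u" "\<not> E y v" "y \<notin> Q" "u \<noteq> v" "v \<noteq> y"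
  using assms by (auto simp: mixed_def complete_def anticomplete_def)

text \<open>Otherwise \<open>y\<close> is the middle of an induced P5, continued on each side by a
  neighbour and then a nonneighbour of \<open>y\<close> in one of the two cliques.\<close>

lemma mixed_unique:
  assumes fam: "clique_family r \<Q>" and Q: "Q \<in> \<Q>" "Q' \<in> \<Q>" and mx: "mixed y Q" "mixed y Q'"
  shows "Q = Q'"
proof (rule ccontr)
  assume ne: "Q \<noteq> Q'"
  obtain u v where 1: "u \<in> Q" "v \<in> Q" "E y u" "\<not> E y v" "u \<noteq> v" using mx(1) by (rule mixedE)
  obtain u' v' where 2: "u' \<in> Q'" "v' \<in> Q'" "E y u'" "\<not> E y v'" "u' \<noteq> v'" using mx(2) by (rule mixedE)
  note n = clique_family_nonedge(1)[OF fam Q ne]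
  have "E v u" "E u' v'" using clique_family_edge[OF fam] Q 1 2 by auto
  then show False
    using P5_free[of v u y u' v'] 1 2 n[OF 1(1) 2(1)] n[OF 1(1) 2(2)] n[OF 1(2) 2(1)] n[OF 1(2) 2(2)]
    by (simp add: E_commute)
qed

lemma mixed_not_in_family:
  assumes "clique_family r \<Q>" "Q \<in> \<Q>" "Q' \<in> \<Q>" "mixed y Q"
  shows "y \<notin> Q'"
  using assms clique_family_nonedge[OF assms(1,3,2)] by (metis mixedE)

text \<open>Together with a neighbour and a nonneighbour in \<open>Q\<close>, \<open>y\<close> forms
  an induced P3. An edge from each of \<open>c\<close> cliques anticomplete to \<open>y\<close>
  would complete it to P3 + cP2.\<close>

lemma mixed_anticomplete_few:
  assumes fam: "clique_family r \<Q>" and Q: "Q \<in> \<Q>" and mx: "mixed y Q"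
  shows "card {R \<in> \<Q>. anticomplete y R} < c"
proof (rule ccontr)
  let ?A = "{R \<in> \<Q>. anticomplete y R}"
  assume "\<not> card ?A < c"
  moreover have "finite ?A" using finite_clique_family[OF fam] by simp
  ultimately obtain h where h: "inj_on h {..<c}" "h ` {..<c} \<subseteq> ?A"
    using card_le_inj[of "{..<c}" ?A] by auto
  obtain u v where uv: "u \<in> Q" "v \<in> Q" "E y u" "\<not> E y v" "u \<noteq> v" "v \<noteq> y"
    using mx by (rule mixedE)
  \<comment> \<open>All members have the size of \<open>Q\<close>, which contains \<open>u\<close>
    and \<open>v\<close>; so each of them contains an edge.\<close>
  have r: "2 \<le> r"
  proof -
    have "card {u, v} \<le> card Q" using uv clique_familyD[OF fam Q] by (intro card_mono) auto
    then show ?thesis using uv clique_familyD[OF fam Q] by simp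
  qed
  have "\<exists>e. fst e \<in> h i \<and> snd e \<in> h i \<and> fst e \<noteq> snd e" if "i < c" for i
  proof -
    have "card (h i) = r" using h that clique_familyD(2)[OF fam, of "h i"] by auto
    then obtain a b where "a \<in> h i" "b \<in> h i" "a \<noteq> b"
      using r by (metis card_2_iff' obtain_subset_with_card_n subset_iff)
    then show ?thesis by (intro exI[of _ "(a, b)"]) simp
  qed
  then obtain e where e: "\<And>i. i < c \<Longrightarrow> fst (e i) \<in> h i \<and> snd (e i) \<in> h i \<and> fst (e i) \<noteq> snd (e i)"
    by metis
  have hA: "h i \<in> \<Q>" "anticomplete y (h i)" "h i \<noteq> Q" if "i < c" for i
    using h that uv by (auto simp: anticomplete_def)
  have hne: "h i \<noteq> h j" if "i < c" "j < c" "i \<noteq> j" for i j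
    using h(1) that by (auto simp: inj_on_def)
  show False
  proof (rule P3_matching_free[of y u v "\<lambda>i. fst (e i)" "\<lambda>i. snd (e i)"])
    show "E u v" using clique_family_edge[OF fam Q] uv by auto
    show "E (fst (e i)) (snd (e i))" if "i < c" for i
      using clique_family_edge[OF fam hA(1)[OF that]] e[OF that] by auto
    show "\<not> E x (fst (e i)) \<and> \<not> E x (snd (e i))" if "i < c" "x \<in> {y, u, v}" for i x
      using hA[OF that(1)] e[OF that(1)] that(2) uv clique_family_nonedge[OF fam Q, of "h i"]
      by (auto simp: anticomplete_def)
    show "\<not> E (fst (e i)) (fst (e j)) \<and> \<not> E (fst (e i)) (snd (e j)) \<and> \<not> E (snd (e i)) (snd (e j))"
      if "i < c" "j < c" "i \<noteq> j" for i j
      using clique_family_nonedge[OF fam hA(1) hA(1) hne] e that by blast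
  qed (use uv in auto)
qed

lemma mixed_adjacent:
  assumes fam: "clique_family r \<Q>" and big: "2 * c + 2 \<le> card \<Q>"
    and Q: "Q \<in> \<Q>" "Q' \<in> \<Q>" "Q \<noteq> Q'" and mx: "mixed y Q" "mixed z Q'"
  shows "E y z"
proof (rule ccontr)
  assume nE: "\<not> E y z"
  let ?A = "{R \<in> \<Q>. anticomplete y R}" and ?B = "{R \<in> \<Q>. anticomplete z R}"
  have fin: "finite \<Q>" using finite_clique_family[OF fam] .
  \<comment> \<open>\<open>Q\<close>, \<open>Q'\<close> and the cliques anticomplete to
    \<open>y\<close> or to \<open>z\<close> do not exhaust the family. A remaining clique
    \<open>R\<close> provides a common neighbour \<open>l\<close> of \<open>y\<close> and
    \<open>z\<close>.\<close>
  have "card ({Q, Q'} \<union> ?A \<union> ?B) \<le> card {Q, Q'} + card ?A + card ?B"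
    by (meson add_le_mono card_Un_le le_trans order_refl)
  also have "\<dots> < card \<Q>"
    using mixed_anticomplete_few[OF fam Q(1) mx(1)] mixed_anticomplete_few[OF fam Q(2) mx(2)] big Q(3)
    by simp
  finally have "\<not> \<Q> \<subseteq> {Q, Q'} \<union> ?A \<union> ?B"
    using card_mono[of "{Q, Q'} \<union> ?A \<union> ?B" \<Q>] fin by auto
  then obtain R where R: "R \<in> \<Q>" "R \<noteq> Q" "R \<noteq> Q'" "\<not> anticomplete y R" "\<not> anticomplete z R" by blast
  \<comment> \<open>Each of \<open>y\<close> and \<open>z\<close> is mixed on one clique only, so on
    any other clique it is complete or anticomplete.\<close>
  have cmpl: "complete x S \<or> anticomplete x S"
    if "mixed x T" "T \<in> \<Q>" "S \<in> \<Q>" "S \<noteq> T" for x S T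
    using mixed_unique[OF fam that(2,3,1)] mixed_not_in_family[OF fam that(2,3,1)] that(4)
    by (auto simp: mixed_def)
  have "complete y R" "complete z R" using cmpl[OF mx(1) Q(1)] cmpl[OF mx(2) Q(2)] R by auto
  moreover obtain l where l: "l \<in> R" using R(4) by (auto simp: anticomplete_def)
  ultimately have yl: "E y l" "E z l" by (auto simp: complete_def)
  obtain u v where 1: "u \<in> Q" "v \<in> Q" "E y u" "\<not> E y v" using mx(1) by (rule mixedE)
  obtain u' v' where 2: "u' \<in> Q'" "v' \<in> Q'" "E z u'" "\<not> E z v'" using mx(2) by (rule mixedE)
  have V: "v \<in> V" "v' \<in> V" using 1 2 clique_familyD(3)[OF fam] Q by auto
  note non = clique_family_nonedge(1)[OF fam Q 1(2) 2(2)] clique_family_nonedge(1)[OF fam Q 1(1) 2(2)]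
    clique_family_nonedge(1)[OF fam R(1) Q(1) R(2) l]
    clique_family_nonedge(1)[OF fam R(1) Q(2) R(3) l]
  have "complete z Q \<or> anticomplete z Q" "complete y Q' \<or> anticomplete y Q'"
    using cmpl[OF mx(2) Q(2) Q(1)] cmpl[OF mx(1) Q(1) Q(2)] Q(3) by auto
  then consider "complete z Q" "complete y Q'" | "complete z Q" "anticomplete y Q'"
    | "anticomplete z Q" "complete y Q'" | "anticomplete z Q" "anticomplete y Q'" by blast
  then show False
  \<comment> \<open>If both are complete to the other's clique, \<open>v'\<close> and
    \<open>v\<close> are private neighbours and give a P5. If just one is, it has a private
    neighbour in the other's clique and the nonneighbour in its own clique is isolated: a co-gem. If
    neither is, \<open>u\<close> and \<open>v'\<close> play these two roles.\<close>
  proof cases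
    case 1
    then show ?thesis
      using nonadjacent_crossing[of y z v' v l] nE yl \<open>v \<in> Q\<close> \<open>\<not> E y v\<close> 2 non
      by (auto simp: complete_def E_commute)
  next
    case 2
    then show ?thesis
      using nonadjacent_nested[of z y v l v'] nE yl V \<open>v \<in> Q\<close> \<open>\<not> E y v\<close> \<open>v' \<in> Q'\<close> \<open>\<not> E z v'\<close> non
      by (auto simp: complete_def anticomplete_def E_commute)
  next
    case 3
    then show ?thesis
      using nonadjacent_nested[of y z v' l v] nE yl V \<open>v \<in> Q\<close> \<open>\<not> E y v\<close> \<open>v' \<in> Q'\<close> \<open>\<not> E z v'\<close> non
      by (auto simp: complete_def anticomplete_def E_commute)
  next
    case 4
    then show ?thesis
      using nonadjacent_nested[of y z u l v'] nE yl V 1 2 non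
      by (auto simp: complete_def anticomplete_def E_commute)
  qed
qed

text \<open>Choose a mixed vertex for each such clique. The choice is injective by
  \<open>mixed_unique\<close>, and the chosen vertices form a clique by
  \<open>mixed_adjacent\<close>.\<close>

lemma mixed_cliques_few:
  assumes fam: "clique_family r \<Q>" and big: "2 * c + 2 \<le> card \<Q>"
  shows "card {Q \<in> \<Q>. \<exists>y. mixed y Q} \<le> k"
proof -
  let ?J = "{Q \<in> \<Q>. \<exists>y. mixed y Q}"
  have "\<forall>Q\<in>?J. \<exists>y. mixed y Q" by blast
  then obtain y where y: "\<And>Q. Q \<in> ?J \<Longrightarrow> mixed (y Q) Q" by (metis bchoice)
  have "inj_on y ?J"
    by (rule inj_onI) (metis (no_types, lifting) fam y mem_Collect_eq mixed_unique)
  moreover have "is_clique (y ` ?J)"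
    unfolding is_clique_def
  proof (intro conjI ballI impI)
    show "y ` ?J \<subseteq> V"
    proof
      fix x assume "x \<in> y ` ?J"
      then obtain Q where "mixed x Q" using y by blast
      then show "x \<in> V" using E_V by (meson mixedE)
    qed
    fix u v assume "u \<in> y ` ?J" "v \<in> y ` ?J" "u \<noteq> v"
    then obtain Q Q' where "Q \<in> ?J" "Q' \<in> ?J" "u = y Q" "v = y Q'" "Q \<noteq> Q'" by blast
    then show "E u v" using mixed_adjacent[OF fam big, of Q Q'] y by auto
  qed
  ultimately show ?thesis using card_clique_le card_image by metis
qed

section \<open>Bounding the number of modules\<close>

text \<open>Otherwise the colours of one clique could be reused on the other.\<close>

lemma distinguishing_vertex:
  assumes fam: "clique_family r \<Q>" and r: "0 < r" and Q: "Q \<in> \<Q>" "R \<in> \<Q>" "Q \<noteq> R"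
    and nmx: "\<And>y. \<not> mixed y Q" "\<And>y. \<not> mixed y R"
  obtains y where "complete y Q" "anticomplete y R" | y where "anticomplete y Q" "complete y R"
proof -
  have "\<exists>y. complete y Q \<and> anticomplete y R \<or> anticomplete y Q \<and> complete y R"
  proof (rule ccontr)
    assume none: "\<not> ?thesis"
    \<comment> \<open>Without a distinguishing vertex, every outside neighbour of \<open>Q\<close>
      is complete to \<open>R\<close>.\<close>
    have nb: "E y b" if "E y a" "a \<in> Q" "y \<notin> Q" "b \<in> R" for y a b
    proof -
      have "complete y Q" using nmx(1)[of y] that by (auto simp: mixed_def anticomplete_def)
      moreover have "y \<notin> R" using clique_family_nonedge[OF fam Q] that E_sym by blast
      ultimately have "complete y R" using nmx(2)[of y] none by (auto simp: mixed_def)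
      then show ?thesis using that by (simp add: complete_def)
    qed
    note D = clique_familyD[OF fam Q(1)] clique_familyD[OF fam Q(2)]
    obtain q where q: "q \<in> Q" using r D by (metis card.empty all_not_in_conv less_nat_zero_code)
    obtain f :: "'a \<Rightarrow> nat" where f: "\<forall>u\<in>V - {q}. f u < k - 1"
      "\<forall>u w. E u w \<longrightarrow> u \<noteq> q \<longrightarrow> w \<noteq> q \<longrightarrow> f u \<noteq> f w"
      using ex_colouring_remove[of q] q D by auto
    obtain h where h: "bij_betw h Q R"
      using finite_same_card_bij[of Q R] D by auto
    have hR: "h u \<in> R" if "u \<in> Q" for u using h that by (auto simp: bij_betw_def)
    have notQ: "v \<notin> Q" if "v \<in> R" for v using clique_family_nonedge[OF fam Q] that by blast
    \<comment> \<open>\<open>f\<close> colours the graph without \<open>q\<close> with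
      \<open>k - 1\<close> colours. Copying the colours of \<open>R\<close> onto \<open>Q\<close>
      along \<open>h\<close> never consults \<open>f q\<close>, as \<open>q\<close> lies in
      \<open>Q\<close>.\<close>
    define g where "g u = (if u \<in> Q then f (h u) else f u)" for u
    have half: "g u \<noteq> g v" if uv: "E u v" and "u \<in> Q" for u v
    proof (cases "v \<in> Q")
      case True
      have "u \<noteq> v" using uv E_irrefl by auto
      then have "h u \<noteq> h v" using h that True by (auto simp: bij_betw_def inj_on_def)
      then have "E (h u) (h v)" using clique_family_edge[OF fam Q(2)] hR that True by auto
      then show ?thesis
        using f(2) that True hR notQ q unfolding g_def by metis
    next
      case False
      \<comment> \<open>An outside neighbour of \<open>u\<close> is also a neighbour of the vertex
        whose colour \<open>u\<close> receives, so the copied colour is safe.\<close>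
      have "E v (h u)" using nb[of v u "h u"] uv E_sym hR that False by blast
      then show ?thesis
        using f(2) that False hR notQ q unfolding g_def by metis
    qed
    show False
    proof (rule no_smaller_colouring[of g])
      fix v assume "v \<in> V"
      then have "(if v \<in> Q then h v else v) \<in> V - {q}"
        using hR[of v] notQ[of "h v"] q D by auto
      then show "g v < k - 1" using f(1) by (auto simp: g_def split: if_splits)
    next
      fix u v assume uv: "E u v"
      show "g u \<noteq> g v"
      proof (cases "u \<in> Q \<or> v \<in> Q")
        case True
        then show ?thesis using half[of u v] half[of v u] uv E_sym[OF uv] by auto
      next
        case False
        then have "u \<noteq> q" "v \<noteq> q" using q by auto
        then show ?thesis using False f(2) uv by (simp add: g_def)
      qed
    qed
  qed
  then show thesis using that by blast
qed

text \<open>\<open>N\<close> plays the role of a Ramsey number for \<open>Suc k\<close> and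
  \<open>p\<close>, and \<open>p\<close> that of the bound for cliques one larger. Each module is
  determined by the sets of \<open>\<F>\<close> containing it, of which there are fewer than
  \<open>N\<close>.\<close>

lemma modules_bound:
  assumes fam: "clique_family r \<Q>" and r: "0 < r" and nmx: "\<And>y Q. Q \<in> \<Q> \<Longrightarrow> \<not> mixed y Q"
    and ramsey: "\<And>(X :: 'a set) F. finite X \<Longrightarrow> N \<le> card X \<Longrightarrow>
      \<exists>Y\<subseteq>X. card Y = Suc k \<and> clique Y F \<or> card Y = p \<and> indep Y F"
    and larger: "\<And>\<R>. clique_family (Suc r) \<R> \<Longrightarrow> card \<R> < p"
  shows "card \<Q> \<le> 2 ^ N"
proof -
  define T where "T y = {Q \<in> \<Q>. complete y Q}" for y
  have fin: "finite \<Q>" using finite_clique_family[OF fam] .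
  have ne: "Q \<noteq> {}" if "Q \<in> \<Q>" for Q using clique_familyD(2)[OF fam that] r by auto
  define \<F> where "\<F> = {T y | y. y \<in> V \<and> T y \<noteq> {} \<and> T y \<noteq> \<Q>}"
  have finF: "finite \<F>" using finite_V by (simp add: \<F>_def)
  have outside: "y \<notin> Q" if yQ: "T y \<noteq> {}" "Q \<in> \<Q>" for y Q
  proof
    assume "y \<in> Q"
    obtain R where R: "R \<in> \<Q>" "complete y R" using yQ(1) by (auto simp: T_def)
    then obtain x where "x \<in> R" "E y x" using ne by (fastforce simp: complete_def)
    then have "R = Q" using clique_family_nonedge(1)[OF fam] R \<open>y \<in> Q\<close> yQ(2) by metis
    then show False using R \<open>y \<in> Q\<close> E_irrefl by (auto simp: complete_def)
  qed
  \<comment> \<open>Nonemptiness of \<open>T y\<close> places \<open>y\<close> outside every member,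
    so failing to be complete to a module means being anticomplete to it.\<close>
  have anti: "anticomplete y Q" if "T y \<noteq> {}" "Q \<in> \<Q>" "Q \<notin> T y" for y Q
    using nmx[OF that(2), of y] outside[OF that(1,2)] that by (auto simp: mixed_def T_def)
  have disj: "T y = T z \<or> T y \<inter> T z = {}"
    if y: "T y \<noteq> {}" "T y \<noteq> \<Q>" and z: "T z \<noteq> {}" "T z \<noteq> \<Q>" and nE: "\<not> E y z" for y z
  proof -
    \<comment> \<open>If the two sets share \<open>L\<close>, then no \<open>A\<close> lies in
      \<open>T y\<close> alone; exchanging \<open>y\<close> and \<open>z\<close> gives
      equality.\<close>
    have key: False if y: "T y \<noteq> {}" "T y \<noteq> \<Q>" and z: "T z \<noteq> {}" "T z \<noteq> \<Q>" and nE: "\<not> E y z"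
      and A: "A \<in> T y" "A \<notin> T z" and L: "L \<in> T y" "L \<in> T z" for y z A L
    proof -
      obtain a l where al: "a \<in> A" "l \<in> L" using ne A L by (fastforce simp: T_def)
      have AL: "A \<in> \<Q>" "L \<in> \<Q>" "A \<noteq> L" using A L by (auto simp: T_def)
      have e: "E y a" "\<not> E z a" "E y l" "E z l" "\<not> E a l"
        using A L al anti[OF z(1) AL(1) A(2)] clique_family_nonedge[OF fam AL]
        by (auto simp: T_def complete_def anticomplete_def)
      show False
      proof (cases "T z \<subseteq> T y")
        case True
        \<comment> \<open>\<open>T y\<close> is proper, so some module lies outside both nested
          sets; its vertex \<open>w\<close> is the isolated vertex of the co-gem.\<close>
        obtain W where W: "W \<in> \<Q>" "W \<notin> T y" "W \<notin> T z"
          using y(2) True by (auto simp: T_def)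
        then obtain w where w: "w \<in> W" using ne by blast
        have "\<not> E y w" "\<not> E z w"
          using anti[OF y(1) W(1,2)] anti[OF z(1) W(1,3)] w by (auto simp: anticomplete_def)
        moreover have "\<not> E a w" "\<not> E l w"
          using clique_family_nonedge(1)[OF fam AL(1) W(1)] clique_family_nonedge(1)[OF fam AL(2) W(1)]
            A L W al w by blast+
        moreover have "w \<in> V" using clique_familyD(3)[OF fam W(1)] w by blast
        ultimately show False using nonadjacent_nested[of y z a l w] nE e by blast
      next
        case False
        then obtain B where B: "B \<in> T z" "B \<notin> T y" by blast
        then have BQ: "B \<in> \<Q>" by (simp add: T_def)
        then obtain b where b: "b \<in> B" using ne by blast
        have "E z b" "\<not> E y b"
          using B b anti[OF y(1) BQ B(2)] by (auto simp: T_def complete_def anticomplete_def)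
        moreover have "\<not> E a b" "\<not> E b l"
          using clique_family_nonedge(1)[OF fam AL(1) BQ] clique_family_nonedge(1)[OF fam BQ AL(2)]
            A L B al b by blast+
        ultimately show False using nonadjacent_crossing[of y z a b l] nE e by blast
      qed
    qed
    show ?thesis using key[OF y z nE] key[OF z y] nE E_sym by blast
  qed
  have "card \<F> < N"
  proof (rule ccontr)
    assume "\<not> card \<F> < N"
    \<comment> \<open>Ramsey's theorem is applied to one representative vertex per set, so that
      distinct vertices have distinct sets.\<close>
    obtain rep where rep: "\<And>A. A \<in> \<F> \<Longrightarrow> rep A \<in> V \<and> T (rep A) = A \<and> A \<noteq> {} \<and> A \<noteq> \<Q>"
      unfolding \<F>_def by atomize_elim (rule choice, blast)
    have "inj_on rep \<F>" by (rule inj_onI) (metis rep)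
    then have "N \<le> card (rep ` \<F>)" using \<open>\<not> card \<F> < N\<close> by (simp add: card_image)
    then obtain Y where Y: "Y \<subseteq> rep ` \<F>"
      and cases: "card Y = Suc k \<and> clique Y {{u, v} | u v. E u v} \<or>
        card Y = p \<and> indep Y {{u, v} | u v. E u v}"
      using ramsey[of "rep ` \<F>"] finF by blast
    have edge: "{u, v} \<in> {{u, v} | u v. E u v} \<longleftrightarrow> E u v" for u v
      using E_sym by (auto simp: doubleton_eq_iff)
    have YV: "y \<in> V" "T y \<noteq> {}" "T y \<noteq> \<Q>" if "y \<in> Y" for y
      using rep Y that by auto
    have "\<not> is_clique Y" if "card Y = Suc k" using card_clique_le[of Y] that by auto
    then have card_Y: "card Y = p" and ind: "indep Y {{u, v} | u v. E u v}"
      using cases YV(1) unfolding is_clique_def clique_def edge by blast+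
    have nE: "\<not> E u v" if "u \<in> Y" "v \<in> Y" for u v
      using ind that E_irrefl unfolding indep_def edge by metis
    have disjY: "T y \<inter> T z = {}" if "y \<in> Y" "z \<in> Y" "y \<noteq> z" for y z
    proof -
      have "T y \<noteq> T z" using rep Y that by (metis (no_types, opaque_lifting) imageE subsetD)
      then show ?thesis using disj YV nE that by metis
    qed
    have "\<forall>y\<in>Y. \<exists>Q. Q \<in> T y" using YV(2) by blast
    then obtain pick where pick: "\<And>y. y \<in> Y \<Longrightarrow> pick y \<in> T y" by (metis bchoice)
    have pQ: "pick y \<in> \<Q>" "complete y (pick y)" if "y \<in> Y" for y
      using pick[OF that] by (auto simp: T_def)
    have non: "u \<noteq> v \<and> \<not> E u v"
      if yz: "y \<in> Y" "z \<in> Y" "y \<noteq> z" and uv: "u \<in> insert y (pick y)" "v \<in> insert z (pick z)" for y z u v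
    proof -
      \<comment> \<open>Disjointness of the sets makes each of \<open>y\<close> and \<open>z\<close>
        anticomplete to the module picked for the other.\<close>
      have "pick y \<notin> T z" "pick z \<notin> T y" using pick disjY yz by blast+
      then have "anticomplete z (pick y)" "anticomplete y (pick z)"
        using anti YV(2) pQ(1) yz by blast+
      then have anti': "\<And>a. a \<in> pick y \<Longrightarrow> \<not> E a z" "\<And>b. b \<in> pick z \<Longrightarrow> \<not> E y b"
        using E_sym unfolding anticomplete_def by blast+
      have "pick y \<noteq> pick z" using pick[OF yz(1)] pick[OF yz(2)] disjY[OF yz] by auto
      note ne_pick = clique_family_nonedge[OF fam pQ(1)[OF yz(1)] pQ(1)[OF yz(2)] this]
      have "y \<notin> pick z" "z \<notin> pick y"
        using outside[OF YV(2)[OF yz(1)] pQ(1)[OF yz(2)]] outside[OF YV(2)[OF yz(2)] pQ(1)[OF yz(1)]] .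
      then show ?thesis
        using uv yz(3) nE[OF yz(1,2)] anti' ne_pick by blast
    qed
    \<comment> \<open>Adding each vertex to its picked module yields \<open>p\<close> pairwise
      anticomplete cliques of size \<open>Suc r\<close>, against \<open>larger\<close>.\<close>
    let ?\<R> = "(\<lambda>y. insert y (pick y)) ` Y"
    have "clique_family (Suc r) ?\<R>"
      unfolding clique_family_def
    proof (intro conjI ballI impI)
      fix R assume "R \<in> ?\<R>"
      then obtain y where y: "y \<in> Y" "R = insert y (pick y)" by blast
      have "y \<notin> pick y" using outside[OF YV(2) pQ(1)] y(1) by blast
      then show "card R = Suc r" using clique_familyD[OF fam pQ(1)[OF y(1)]] y by simp
      show "is_clique R"
      proof -
        have "\<forall>u\<in>pick y. E y u \<and> E u y"
          using pQ(2)[OF y(1)] E_sym unfolding complete_def by blast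
        then show ?thesis
          using clique_familyD(1)[OF fam pQ(1)[OF y(1)]] YV(1)[OF y(1)]
          unfolding is_clique_def y(2) by simp
      qed
    next
      fix R R' u v assume "R \<in> ?\<R>" "R' \<in> ?\<R>" "R \<noteq> R'" "u \<in> R" "v \<in> R'"
      then obtain y z where "y \<in> Y" "z \<in> Y" "y \<noteq> z" "u \<in> insert y (pick y)" "v \<in> insert z (pick z)"
        by blast
      then show "u \<noteq> v" "\<not> E u v" using non by blast+
    qed
    moreover have "inj_on (\<lambda>y. insert y (pick y)) Y"
      by (rule inj_onI) (metis non insertI1)
    then have "card ?\<R> = p" using card_Y by (simp add: card_image)
    ultimately show False using larger by blast
  qed
  have "inj_on (\<lambda>Q. {A \<in> \<F>. Q \<in> A}) \<Q>"
  proof (rule inj_onI, rule ccontr)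
    fix Q R assume Q: "Q \<in> \<Q>" and R: "R \<in> \<Q>" and ne': "Q \<noteq> R"
      and eq: "{A \<in> \<F>. Q \<in> A} = {A \<in> \<F>. R \<in> A}"
    have sep: False if y: "complete y A" "anticomplete y B" and AB: "A \<in> \<Q>" "B \<in> \<Q>"
      and eq: "{X \<in> \<F>. A \<in> X} = {X \<in> \<F>. B \<in> X}" for y A B
    proof -
      \<comment> \<open>As \<open>A\<close> is nonempty, \<open>y\<close> has a neighbour and hence
        lies in \<open>V\<close>, as membership of \<open>T y\<close> in \<open>\<F>\<close>
        demands.\<close>
      obtain x where "E y x" using y ne[OF AB(1)] by (auto simp: complete_def)
      moreover have "A \<in> T y" "B \<notin> T y"
        using y AB ne[OF AB(2)] by (auto simp: T_def complete_def anticomplete_def)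
      ultimately have "T y \<in> \<F>" using E_V AB by (auto simp: \<F>_def)
      then show False using eq \<open>A \<in> T y\<close> \<open>B \<notin> T y\<close> by blast
    qed
    show False
      by (rule distinguishing_vertex[OF fam r Q R ne' nmx[OF Q] nmx[OF R]])
        (use sep[OF _ _ Q R eq] sep[OF _ _ R Q eq[symmetric]] in blast)+
  qed
  then have "card \<Q> \<le> card (Pow \<F>)"
    using finF by (intro card_inj_on_le) auto
  also have "\<dots> \<le> 2 ^ N"
    using \<open>card \<F> < N\<close> by (simp add: card_Pow finF)
  finally show ?thesis .
qed

end

section \<open>Downward induction on clique size and the bound on the order\<close>

lemma clique_families_bounded:
  "\<exists>m. \<forall>V (E :: 'a \<Rightarrow> 'a \<Rightarrow> bool) \<Q>. critical_forbidden V E k c \<longrightarrow>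
     critical_forbidden.clique_family V E (Suc k - i) \<Q> \<longrightarrow> i \<le> k \<longrightarrow> card \<Q> < m"
proof (induction i)
  \<comment> \<open>The clique size \<open>Suc k - i\<close> runs from \<open>k + 1\<close>, where
    no clique exists, down to 1. The bound \<open>m\<close> is chosen before the graph.\<close>
  case 0
  have "card \<Q> < 1" if "critical_forbidden V E k c" "critical_forbidden.clique_family V E (Suc k) \<Q>"
    for V and E :: "'a \<Rightarrow> 'a \<Rightarrow> bool" and \<Q>
  proof -
    interpret critical_forbidden V E k c by fact
    have "\<Q> = {}"
      using that(2) card_clique_le by (force simp: clique_family_def)
    then show ?thesis by simp
  qed
  then show ?case by (metis diff_zero)
next
  case (Suc i)
  then obtain p where p: "\<And>V (E :: 'a \<Rightarrow> 'a \<Rightarrow> bool) \<Q>. \<lbrakk>critical_forbidden V E k c;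
      critical_forbidden.clique_family V E (Suc k - i) \<Q>; i \<le> k\<rbrakk> \<Longrightarrow> card \<Q> < p" by blast
  obtain N where N: "\<And>(X :: 'a set) F. finite X \<Longrightarrow> N \<le> card X \<Longrightarrow>
      \<exists>Y\<subseteq>X. card Y = Suc k \<and> clique Y F \<or> card Y = p \<and> indep Y F"
    using ramsey2[where ?'a='a, of "Suc k" p] by blast
  \<comment> \<open>The constant covers both cases: fewer than \<open>2 * c + 2\<close> cliques, or
    at most \<open>k\<close> with a mixed vertex and at most \<open>2 ^ N\<close> modules.\<close>
  have "card \<Q> < 2 * c + 3 + k + 2 ^ N"
    if ctx: "critical_forbidden V E k c"
      and Q: "critical_forbidden.clique_family V E (Suc k - Suc i) \<Q>" and i: "Suc i \<le> k"
    for V and E :: "'a \<Rightarrow> 'a \<Rightarrow> bool" and \<Q>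
  proof (cases "2 * c + 2 \<le> card \<Q>")
    case True
    interpret critical_forbidden V E k c by fact
    let ?r = "Suc k - Suc i" and ?J = "{Q \<in> \<Q>. \<exists>y. mixed y Q}"
    have fam: "clique_family ?r (\<Q> - ?J)" by (rule clique_family_subset[OF Q]) blast
    have r: "Suc ?r = Suc k - i" "0 < ?r" using i by auto
    have "card (\<Q> - ?J) \<le> 2 ^ N"
      by (rule modules_bound[OF fam r(2)]) (use N p[OF ctx] r(1) i in auto)
    moreover have "card ?J \<le> k" using mixed_cliques_few[OF Q True] .
    moreover have "card \<Q> \<le> card ?J + card (\<Q> - ?J)"
      using finite_clique_family[OF Q] card_Un_le[of ?J "\<Q> - ?J"] by (simp add: Un_absorb1)
    ultimately show ?thesis by linarith
  qed simp
  then show ?case by blast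
qed

text \<open>The singletons of an independent set form a family of 1-cliques, so independent sets and
  cliques are both bounded and Ramsey's theorem applies to \<open>V\<close>.\<close>

lemma critical_forbidden_bounded:
  "\<exists>M. \<forall>V (E :: 'a \<Rightarrow> 'a \<Rightarrow> bool). critical_forbidden V E k c \<longrightarrow> card V < M"
proof (cases "k = 0")
  case True
  have "card V < 1" if "critical_forbidden V E k c" for V and E :: "'a \<Rightarrow> 'a \<Rightarrow> bool"
  proof -
    interpret critical_forbidden V E k c by fact
    show ?thesis using ex_colouring True by (auto simp: card_eq_0_iff)
  qed
  then show ?thesis by blast
next
  case False
  obtain m where m: "\<And>V (E :: 'a \<Rightarrow> 'a \<Rightarrow> bool) \<Q>. \<lbrakk>critical_forbidden V E k c;
      critical_forbidden.clique_family V E 1 \<Q>\<rbrakk> \<Longrightarrow> card \<Q> < m"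
    using clique_families_bounded[where ?'a='a, of k c k] by auto
  obtain M where M: "\<And>(X :: 'a set) F. finite X \<Longrightarrow> M \<le> card X \<Longrightarrow>
      \<exists>Y\<subseteq>X. card Y = Suc k \<and> clique Y F \<or> card Y = m \<and> indep Y F"
    using ramsey2[where ?'a='a, of "Suc k" m] by blast
  have "card V < M" if ctx: "critical_forbidden V E k c" for V and E :: "'a \<Rightarrow> 'a \<Rightarrow> bool"
  proof (rule ccontr)
    interpret critical_forbidden V E k c by fact
    assume "\<not> card V < M"
    then obtain Y where Y: "Y \<subseteq> V" "card Y = Suc k \<and> clique Y {{u, v} | u v. E u v} \<or>
        card Y = m \<and> indep Y {{u, v} | u v. E u v}"
      using M[OF finite_V] by (meson not_less)
    have edge: "{u, v} \<in> {{u, v} | u v. E u v} \<longleftrightarrow> E u v" for u v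
      using E_sym by (auto simp: doubleton_eq_iff)
    have "\<not> is_clique Y" if "card Y = Suc k" using card_clique_le[of Y] that by auto
    then have "card Y = m" "indep Y {{u, v} | u v. E u v}"
      using Y unfolding is_clique_def clique_def edge by blast+
    moreover have "\<not> E u v" if "u \<in> Y" "v \<in> Y" for u v
      using \<open>indep Y _\<close> that E_irrefl unfolding indep_def edge by metis
    ultimately have "clique_family 1 ((\<lambda>y. {y}) ` Y)"
      using Y(1) by (auto simp: clique_family_def is_clique_def)
    then have "card ((\<lambda>y. {y}) ` Y) < m" using m[OF ctx] by blast
    then show False using \<open>card Y = m\<close> by (simp add: card_image)
  qed
  then show ?thesis by blast
qed

section \<open>From pair graphs to the abstract setting\<close>

lemma not_free_ofI:
  assumes "pair_graph H" "pair_graph G"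
    and inj: "inj_on f (pverts H)" and sub: "f ` pverts H \<subseteq> pverts G"
    and arcs: "\<And>u v. u \<in> pverts H \<Longrightarrow> v \<in> pverts H \<Longrightarrow> (u, v) \<in> parcs H \<longleftrightarrow> (f u, f v) \<in> parcs G"
  shows "\<not> free_of (with_proj H) (with_proj G)"
proof -
  interpret H: pair_graph H by fact
  interpret G: pair_graph G by fact
  define K where "K = \<lparr> pverts = f ` pverts H,
    parcs = {(a, b) \<in> parcs G. a \<in> f ` pverts H \<and> b \<in> f ` pverts H} \<rparr>"
  have wfH: "pair_wf_digraph H" and wfG: "pair_wf_digraph G"
    by (rule H.pair_wf_digraph_axioms, rule G.pair_wf_digraph_axioms)
  have wfK: "pair_wf_digraph K" by unfold_locales (auto simp: K_def)
  have "induced_subgraph (with_proj K) (with_proj G)"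
    using sub wfK wfG
    by (auto simp: induced_subgraph_def subgraph_def wf_digraph_wp_iff) (auto simp: K_def)
  moreover have "digraph_iso (with_proj H) (with_proj K)"
    unfolding digraph_iso_pair_iff[OF wfH wfK]
    using inj arcs by (intro exI[of _ f]) (auto simp: bij_betw_def K_def)
  ultimately show ?thesis unfolding free_of_def by blast
qed

lemma critical_forbidden_pair_graph:
  assumes "pair_graph G" and k: "k \<ge> 1" and crit: "vertex_critical k (with_proj G)"
    and co_gem: "free_of (with_proj co_gem) (with_proj G)"
    and P5: "free_of (with_proj (path_graph 5)) (with_proj G)"
    and P3: "free_of (with_proj (disjoint_union (path_graph 3) (copies c (path_graph 2)))) (with_proj G)"
  shows "critical_forbidden (pverts G) (\<lambda>u v. (u, v) \<in> parcs G) k c"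
proof -
  interpret G: pair_graph G by fact
  have dG: "digraph (with_proj G)" ..
  let ?V = "pverts G" and ?E = "\<lambda>u v. (u, v) \<in> parcs G"
  have sym: "?E u v \<longleftrightarrow> ?E v u" for u v using G.arcs_symmetric by blast
  have irr: "\<not> ?E v v" for v using G.no_loops' by blast
  have inV: "?E u v \<Longrightarrow> u \<in> ?V \<and> v \<in> ?V" for u v using G.in_arcsD1 G.in_arcsD2 by blast
  have chi: "chromatic_number (with_proj G) = k"
    and chi_del: "\<And>v. v \<in> ?V \<Longrightarrow> chromatic_number (G.del_vert v) < k"
    using crit by (auto simp: vertex_critical_def)
  show ?thesis
  proof
    show "finite ?V" by (rule G.pair_finite_verts)
    show "u \<in> ?V" if "?E u v" for u v using inV that by blast
    show "?E v u" if "?E u v" for u v using sym that by blast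
    show "\<not> ?E v v" for v by (rule irr)
  next
    fix a b p q r
    assume 1: "?E a b" "?E b p" "?E p q" "?E q r"
      and 2: "\<not> ?E a p" "\<not> ?E a q" "\<not> ?E a r" "\<not> ?E b q" "\<not> ?E b r" "\<not> ?E p r"
    have dist: "distinct [a, b, p, q, r]" using 1 2 sym irr by auto
    have 3: "?E b a" "?E p b" "?E q p" "?E r q" "\<not> ?E p a" "\<not> ?E q a" "\<not> ?E r a" "\<not> ?E q b"
        "\<not> ?E r b" "\<not> ?E r p"
      using 1 2 sym by blast+
    have V5: "pverts (path_graph 5) = {0, 1, 2, 3, 4}"
      by (auto simp: path_graph_def)
    have "\<not> free_of (with_proj (path_graph 5)) (with_proj G)"
    proof (rule not_free_ofI[where f = "\<lambda>i. [a, b, p, q, r] ! i", OF pair_graph_path_graph assms(1)])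
      show "inj_on (\<lambda>i. [a, b, p, q, r] ! i) (pverts (path_graph 5))"
        using dist unfolding V5 by auto
      show "(\<lambda>i. [a, b, p, q, r] ! i) ` pverts (path_graph 5) \<subseteq> ?V"
        using inV 1 unfolding V5 by auto
      show "(i, j) \<in> parcs (path_graph 5) \<longleftrightarrow> ?E ([a, b, p, q, r] ! i) ([a, b, p, q, r] ! j)"
        if "i \<in> pverts (path_graph 5)" "j \<in> pverts (path_graph 5)" for i j
        using that unfolding V5
        by (elim insertE emptyE) (simp_all add: path_graph_def 1 2 3 irr)
    qed
    then show False using P5 by blast
  next
    fix a b p q w
    assume 1: "?E a b" "?E b p" "?E p q" and 2: "\<not> ?E a p" "\<not> ?E a q" "\<not> ?E b q"
      and w: "w \<in> ?V" "\<not> ?E w a" "\<not> ?E w b" "\<not> ?E w p" "\<not> ?E w q"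
    have dist: "distinct [a, b, p, q, w]" using 1 2 w sym irr by auto
    let ?f = "case_sum (\<lambda>i::nat. [a, b, p, q] ! i) (\<lambda>_::nat. w)"
    have 3: "?E b a" "?E p b" "?E q p" "\<not> ?E p a" "\<not> ?E q a" "\<not> ?E q b"
        "\<not> ?E a w" "\<not> ?E b w" "\<not> ?E p w" "\<not> ?E q w"
      using 1 2 w sym by blast+
    have V: "pverts co_gem = {Inl 0, Inl 1, Inl 2, Inl 3, Inr 0}"
      by (auto simp: co_gem_def disjoint_union_def path_graph_def)
    have "\<not> free_of (with_proj co_gem) (with_proj G)"
    proof (rule not_free_ofI[where f = ?f, OF _ assms(1)])
      show "pair_graph co_gem"
        unfolding co_gem_def by (intro pair_graph_disjoint_union pair_graph_path_graph)
      show "inj_on ?f (pverts co_gem)" using dist unfolding V by auto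
      show "?f ` pverts co_gem \<subseteq> ?V" using inV 1 w unfolding V by auto
      show "(i, j) \<in> parcs co_gem \<longleftrightarrow> ?E (?f i) (?f j)"
        if "i \<in> pverts co_gem" "j \<in> pverts co_gem" for i j
        using that unfolding V
        by (elim insertE emptyE)
          (simp_all add: co_gem_def disjoint_union_def path_graph_def 1 2 3 w irr)
    qed
    then show False using co_gem by blast
  next
    fix x y z and f g :: "nat \<Rightarrow> 'a"
    assume 1: "?E x y" "?E y z" "x \<noteq> z" "\<not> ?E x z"
      and fg: "\<And>i. i < c \<Longrightarrow> ?E (f i) (g i)"
      and sep: "\<And>i v. i < c \<Longrightarrow> v \<in> {x, y, z} \<Longrightarrow> \<not> ?E v (f i) \<and> \<not> ?E v (g i)"
      and sep': "\<And>i j. i < c \<Longrightarrow> j < c \<Longrightarrow> i \<noteq> j \<Longrightarrow>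
        \<not> ?E (f i) (f j) \<and> \<not> ?E (f i) (g j) \<and> \<not> ?E (g i) (g j)"
    let ?H = "disjoint_union (path_graph 3) (copies c (path_graph 2))"
    \<comment> \<open>In the \<open>i\<close>-th copy of P2, vertex 0 is sent to \<open>f i\<close>
      and vertex 1 to \<open>g i\<close>.\<close>
    define h where "h = case_sum (\<lambda>i::nat. [x, y, z] ! i) (\<lambda>(i, j::nat). if j = 0 then f i else g i)"
    have V: "pverts ?H = {Inl 0, Inl 1, Inl 2} \<union> Inr ` ({..<c} \<times> {0, 1})"
      by (auto simp: disjoint_union_def path_graph_def copies_def)
    have A: "(Inl i, Inl j) \<in> parcs ?H \<longleftrightarrow> i < 3 \<and> j < 3 \<and> (j = Suc i \<or> i = Suc j)"
        "(Inl i, Inr b) \<notin> parcs ?H" "(Inr b, Inl i) \<notin> parcs ?H"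
        "(Inr (m, i), Inr (n, j)) \<in> parcs ?H \<longleftrightarrow>
          m = n \<and> m < c \<and> i < 2 \<and> j < 2 \<and> (j = Suc i \<or> i = Suc j)" for i j b m n
      by (auto simp: disjoint_union_def path_graph_def copies_def)
    have x: "x \<noteq> y" "y \<noteq> z" "\<not> ?E z x" "?E y x" "?E z y" using 1 sym irr by auto
    have fg': "?E (g i) (f i)" "f i \<noteq> g i" "g i \<noteq> f i" if "i < c" for i
      using fg[OF that] sym irr by auto
    \<comment> \<open>If \<open>v\<close> were equal to one end of the edge \<open>f i\<close>,
      \<open>g i\<close>, it would be adjacent to the other end.\<close>
    have xs: "\<not> ?E v (f i)" "\<not> ?E v (g i)" "\<not> ?E (f i) v" "\<not> ?E (g i) v" "v \<noteq> f i" "v \<noteq> g i"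
      if "i < c" "v = x \<or> v = y \<or> v = z" for i v
      using sep[of i v] that fg[of i] fg'[of i] sym irr by auto
    \<comment> \<open>The pair \<open>g i\<close>, \<open>f j\<close>, absent from
      \<open>sep'\<close>, is obtained by exchanging \<open>i\<close> and \<open>j\<close> and using
      symmetry.\<close>
    have ss: "\<not> ?E (f i) (f j)" "\<not> ?E (f i) (g j)" "\<not> ?E (g i) (f j)" "\<not> ?E (g i) (g j)"
      "f i \<noteq> f j" "f i \<noteq> g j" "g i \<noteq> g j"
      if "i < c" "j < c" "i \<noteq> j" for i j
      using sep'[OF that] sep'[OF that(2,1)] that fg[of i] fg'[of i] fg[of j] fg'[of j] sym by auto
    have arcs: "\<not> ?E (f i) (f j)" "\<not> ?E (g i) (g j)" "?E (f i) (g j) \<longleftrightarrow> i = j" "?E (g i) (f j) \<longleftrightarrow> i = j"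
      if "i < c" "j < c" for i j
      using ss(1-4)[OF that] fg[OF that(1)] fg'(1)[OF that(1)] irr by auto
    have "\<not> free_of (with_proj ?H) (with_proj G)"
    proof (rule not_free_ofI[where f = h, OF _ assms(1)])
      show "pair_graph ?H"
        by (intro pair_graph_disjoint_union pair_graph_path_graph pair_graph_copies)
      show "inj_on h (pverts ?H)"
        unfolding V inj_on_def
        using 1(3) x(1,2) xs(5,6)[symmetric] xs(5,6) ss(5-7) fg'(2,3)
        by (auto simp: h_def) metis+
      show "h ` pverts ?H \<subseteq> ?V"
        unfolding V using inV 1 fg by (auto simp: h_def) blast+
      show "(u, v) \<in> parcs ?H \<longleftrightarrow> ?E (h u) (h v)"
        if "u \<in> pverts ?H" "v \<in> pverts ?H" for u v
        using that unfolding V using 1 x irr xs(1-4) arcs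
        by (auto simp: h_def A)
    qed
    then show False using P3 by blast
  next
    show "\<exists>f::'a \<Rightarrow> nat. (\<forall>v\<in>?V. f v < k) \<and> (\<forall>u v. ?E u v \<longrightarrow> f u \<noteq> f v)"
      using ex_proper_colouring[OF dG] chi by (auto simp: proper_colouring_def)
  next
    fix h :: "'a \<Rightarrow> nat"
    assume "\<And>v. v \<in> ?V \<Longrightarrow> h v < k - 1" "\<And>u v. ?E u v \<Longrightarrow> h u \<noteq> h v"
    then have "proper_colouring (with_proj G) (k - 1) h" by (auto simp: proper_colouring_def)
    then have "chromatic_number (with_proj G) \<le> k - 1"
      unfolding chromatic_number_def by (metis Least_le)
    \<comment> \<open>Since \<open>k \<ge> 1\<close>, the truncated difference \<open>k - 1\<close>
      is strictly below the chromatic number.\<close>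
    then show False using chi k by simp
  next
    fix v assume v: "v \<in> ?V"
    have "digraph (G.del_vert v)"
    proof -
      interpret D: fin_digraph "G.del_vert v" by (rule G.fin_digraph_del_vert)
      show ?thesis
        by unfold_locales (auto simp: pre_digraph.del_vert_def arc_to_ends_def irr)
    qed
    then obtain f where f: "proper_colouring (G.del_vert v) (chromatic_number (G.del_vert v)) f"
      using ex_proper_colouring by blast
    have "f u < k - 1" if "u \<in> ?V - {v}" for u
    proof -
      have "u \<in> verts (G.del_vert v)" using that by (simp add: pre_digraph.del_vert_def)
      then have "f u < chromatic_number (G.del_vert v)" using f by (simp add: proper_colouring_def)
      then show ?thesis using chi_del[OF v] by simp
    qed
    moreover have "f u \<noteq> f w" if "?E u w" "u \<noteq> v" "w \<noteq> v" for u w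
    proof -
      have "(u, w) \<in> arcs_ends (G.del_vert v)"
        using that by (force simp: arcs_ends_conv pre_digraph.del_vert_def)
      then show ?thesis using f by (auto simp: proper_colouring_def)
    qed
    ultimately show "\<exists>f::'a \<Rightarrow> nat. (\<forall>u\<in>?V - {v}. f u < k - 1) \<and>
      (\<forall>u w. ?E u w \<longrightarrow> u \<noteq> v \<longrightarrow> w \<noteq> v \<longrightarrow> f u \<noteq> f w)" by blast
  qed
qed

section \<open>Finitely many isomorphism classes of bounded order\<close>

lemma finite_up_to_iso_bounded:
  fixes S :: "'a pair_pre_digraph set"
  assumes graph: "\<And>G. G \<in> S \<Longrightarrow> pair_graph G" and bound: "\<And>G. G \<in> S \<Longrightarrow> card (pverts G) < M"
  shows "finite_up_to_iso S"
proof -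
  have "\<exists>h. bij_betw h (pverts G) {..<card (pverts G)}" if "G \<in> S" for G
  proof -
    interpret pair_graph G using graph that .
    show ?thesis using ex_bij_betw_finite_nat[OF pair_finite_verts] by (simp add: atLeast0LessThan)
  qed
  then obtain h where h: "\<And>G. G \<in> S \<Longrightarrow> bij_betw (h G) (pverts G) {..<card (pverts G)}" by metis
  \<comment> \<open>The code is a copy of \<open>G\<close> on an initial segment of the naturals;
    bounded order leaves finitely many codes.\<close>
  define code where "code G = (card (pverts G), map_prod (h G) (h G) ` parcs G)" for G
  have "code ` S \<subseteq> {..<M} \<times> Pow ({..<M} \<times> {..<M})"
  proof (rule image_subsetI)
    fix G assume G: "G \<in> S"
    interpret pair_graph G using graph G .
    have "h G v < M" if "v \<in> pverts G" for v
      using bij_betwE[OF h[OF G]] bound[OF G] that by fastforce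
    then show "code G \<in> {..<M} \<times> Pow ({..<M} \<times> {..<M})"
      using bound[OF G] by (auto simp: code_def dest: in_arcsD1 in_arcsD2)
  qed
  then have fin: "finite (code ` S)" by (rule finite_subset) simp
  have iso: "(G, H) \<in> iso_rel S" if G: "G \<in> S" and H: "H \<in> S" and eq: "code G = code H" for G H
  proof -
    interpret G: pair_graph G using graph G .
    interpret H: pair_graph H using graph H .
    have wf: "pair_wf_digraph G" "pair_wf_digraph H"
      by (rule G.pair_wf_digraph_axioms, rule H.pair_wf_digraph_axioms)
    \<comment> \<open>Label by \<open>G\<close>, then undo the labelling of \<open>H\<close>: for
      equal codes this is an isomorphism.\<close>
    let ?f = "inv_into (pverts H) (h H) \<circ> h G"
    have card: "card (pverts G) = card (pverts H)"
      and arcs: "map_prod (h G) (h G) ` parcs G = map_prod (h H) (h H) ` parcs H"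
      using eq by (auto simp: code_def)
    have bij: "bij_betw ?f (pverts G) (pverts H)"
      using h[OF G] bij_betw_inv_into[OF h[OF H]] unfolding card by (rule bij_betw_trans)
    have hf: "h H (?f v) = h G v" if "v \<in> pverts G" for v
      using bij_betw_inv_into_right[OF h[OF H]] bij_betwE[OF h[OF G]] that card by simp
    have code_iff: "(u, v) \<in> parcs K \<longleftrightarrow> (h K u, h K v) \<in> map_prod (h K) (h K) ` parcs K"
      if K: "K \<in> S" and uv: "u \<in> pverts K" "v \<in> pverts K" for K u v
    proof -
      interpret K: pair_graph K using graph K .
      have "inj_on (h K) (pverts K)" using h[OF K] by (simp add: bij_betw_def)
      then show ?thesis using uv by (auto dest: K.in_arcsD1 K.in_arcsD2 inj_onD intro: rev_image_eqI)
    qed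
    have "(u, v) \<in> parcs G \<longleftrightarrow> (?f u, ?f v) \<in> parcs H" if "u \<in> pverts G" "v \<in> pverts G" for u v
      using code_iff[OF G that] code_iff[OF H, of "?f u" "?f v"] bij_betwE[OF bij] hf that arcs by simp
    then show ?thesis
      using bij G H by (auto simp: iso_rel_def digraph_iso_pair_iff[OF wf] intro!: exI[of _ ?f])
  qed
  have eqv: "equiv S (iso_rel S)" using graph by (rule equiv_iso_rel)
  \<comment> \<open>A class is recovered from the code of any member, because all graphs of
    \<open>S\<close> with that code belong to it.\<close>
  have "S // iso_rel S \<subseteq> (\<lambda>n. iso_rel S `` {H \<in> S. code H = n}) ` code ` S"
  proof
    fix X assume "X \<in> S // iso_rel S"
    then obtain G where G: "G \<in> S" "X = iso_rel S `` {G}" by (rule quotientE)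
    have "iso_rel S `` {H} = iso_rel S `` {G}" if "H \<in> S" "code H = code G" for H
      using iso[of H G] that G by (intro equiv_class_eq[OF eqv]) auto
    then have "X = iso_rel S `` {H \<in> S. code H = code G}" using G by blast
    then show "X \<in> (\<lambda>n. iso_rel S `` {H \<in> S. code H = n}) ` code ` S" using G by blast
  qed
  then show ?thesis
    unfolding finite_up_to_iso_def using fin finite_subset by blast
qed

theorem theorem3p1:
  fixes k c :: nat
  assumes "k \<ge> 1"
  shows "finite_up_to_iso {G :: 'a pair_pre_digraph. pair_graph G \<and>
    vertex_critical k (with_proj G) \<and>
    free_of (with_proj co_gem) (with_proj G) \<and>
    free_of (with_proj (path_graph 5)) (with_proj G) \<and>
    free_of (with_proj (disjoint_union (path_graph 3) (copies c (path_graph 2)))) (with_proj G)}"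
proof -
  obtain M where M: "\<And>V (E :: 'a \<Rightarrow> 'a \<Rightarrow> bool). critical_forbidden V E k c \<Longrightarrow> card V < M"
    using critical_forbidden_bounded by blast
  show ?thesis
    by (rule finite_up_to_iso_bounded[of _ M])
      (use M critical_forbidden_pair_graph[OF _ assms] in blast)+
qed

end
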